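(* Let $n$ be a positive integer and let $\{p_k, E_k\}$ define a perfect encryption map $R$ for $n$ qubits, i.e., for quantum states in $\mathrm{L}(\mathbb{C}^{2^n})$. Then the Shannon entropy $H(p) = -\sum_k p_k \log_2 p_k$ of the distribution $p = (p_k)_k$ is at least $2n$.
   Context: $\mathrm{L}(\mathcal{H})$ denotes the space of linear operators on the finite-dimensional complex Hilbert space $\mathcal{H}$. A quantum state is a density matrix (positive semi-definite operator of trace $1$). A quantum operation is a completely positive trace preserving (CPTP) linear map. A quantum operation $E : \mathrm{L}(\mathbb{C}^d) \to \mathrm{L}(\mathbb{C}^{D})$ is invertible if there is a quantum operation $F : \mathrm{L}(\mathbb{C}^{D}) \to \mathrm{L}(\mathbb{C}^d)$ with $F(E(\rho)) = \rho$ for every state $\rho\in \mathrm{L}(\mathbb{C}^d)$. A perfect encryption map for states in $\mathrm{L}(\mathbb{C}^d)$ is given by $\{p_k,E_k\}$, where $k$ ranges over a finite set of keys, $(p_k)_k$ is a probability distribution, and each $E_k : \mathrm{L}(\mathbb{C}^d) \to \mathrm{L}(\mathbb{C}^{D})$ is an invertible quantum operation (with $D$ independent of $k$), such that the map $R(\rho) = \sum_k p_k E_k(\rho)$ sends every state $\rho \in \mathrm{L}(\mathbb{C}^d)$ to one and the same fixed state $\sigma \in \mathrm{L}(\mathbb{C}^{D})$. By convention $0\log_2 0 = 0$. *)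

theory Defs
  imports Complex_Main "Jordan_Normal_Form.Schur_Decomposition"
begin

(* Operators on C^d are the matrices in carrier_mat d d.  Maps between operator spaces are
   HOL functions on complex mat; their values outside carrier_mat d d are irrelevant. *)

definition pos_semidef :: "nat \<Rightarrow> complex mat \<Rightarrow> bool" where
  "pos_semidef d A \<longleftrightarrow> A \<in> carrier_mat d d \<and> mat_adjoint A = A \<and>
     (\<forall>v \<in> carrier_vec d. 0 \<le> Re ((A *\<^sub>v v) \<bullet>c v))"

definition mat_trace :: "complex mat \<Rightarrow> complex" where
  "mat_trace A = (\<Sum>i<dim_row A. A $$ (i, i))"

definition quantum_state :: "nat \<Rightarrow> complex mat \<Rightarrow> bool" where
  "quantum_state d \<rho> \<longleftrightarrow> pos_semidef d \<rho> \<and> mat_trace \<rho> = 1"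

definition linear_on_mat :: "nat \<Rightarrow> nat \<Rightarrow> (complex mat \<Rightarrow> complex mat) \<Rightarrow> bool" where
  "linear_on_mat d D E \<longleftrightarrow>
     (\<forall>A \<in> carrier_mat d d. E A \<in> carrier_mat D D) \<and>
     (\<forall>A \<in> carrier_mat d d. \<forall>B \<in> carrier_mat d d. E (A + B) = E A + E B) \<and>
     (\<forall>c. \<forall>A \<in> carrier_mat d d. E (c \<cdot>\<^sub>m A) = c \<cdot>\<^sub>m E A)"

(* The operator (id tensor E)(X) on C^m tensor C^D, for X on C^m tensor C^d, with the basis
   vector e_a tensor e_r of C^m tensor C^d numbered a * d + r: view X as an m x m block
   matrix with blocks of size d x d and apply E to every block. *)
definition ampliation ::
    "nat \<Rightarrow> nat \<Rightarrow> nat \<Rightarrow> (complex mat \<Rightarrow> complex mat) \<Rightarrow> complex mat \<Rightarrow> complex mat" where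
  "ampliation m d D E X =
     mat (m * D) (m * D) (\<lambda>(i, j).
       E (mat d d (\<lambda>(r, s). X $$ ((i div D) * d + r, (j div D) * d + s))) $$ (i mod D, j mod D))"

definition completely_positive :: "nat \<Rightarrow> nat \<Rightarrow> (complex mat \<Rightarrow> complex mat) \<Rightarrow> bool" where
  "completely_positive d D E \<longleftrightarrow>
     (\<forall>m X. pos_semidef (m * d) X \<longrightarrow> pos_semidef (m * D) (ampliation m d D E X))"

definition trace_preserving :: "nat \<Rightarrow> (complex mat \<Rightarrow> complex mat) \<Rightarrow> bool" where
  "trace_preserving d E \<longleftrightarrow> (\<forall>A \<in> carrier_mat d d. mat_trace (E A) = mat_trace A)"

definition quantum_operation :: "nat \<Rightarrow> nat \<Rightarrow> (complex mat \<Rightarrow> complex mat) \<Rightarrow> bool" where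
  "quantum_operation d D E \<longleftrightarrow>
     linear_on_mat d D E \<and> completely_positive d D E \<and> trace_preserving d E"

definition invertible_operation :: "nat \<Rightarrow> nat \<Rightarrow> (complex mat \<Rightarrow> complex mat) \<Rightarrow> bool" where
  "invertible_operation d D E \<longleftrightarrow> quantum_operation d D E \<and>
     (\<exists>F. quantum_operation D d F \<and> (\<forall>\<rho>. quantum_state d \<rho> \<longrightarrow> F (E \<rho>) = \<rho>))"

definition probability_distribution :: "'k set \<Rightarrow> ('k \<Rightarrow> real) \<Rightarrow> bool" where
  "probability_distribution K p \<longleftrightarrow> finite K \<and> (\<forall>k \<in> K. 0 \<le> p k) \<and> (\<Sum>k\<in>K. p k) = 1"

definition encryption_map ::
    "nat \<Rightarrow> 'k set \<Rightarrow> ('k \<Rightarrow> real) \<Rightarrow> ('k \<Rightarrow> complex mat \<Rightarrow> complex mat) \<Rightarrow> complex mat \<Rightarrow> complex mat" where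
  "encryption_map D K p E \<rho> =
     finsum (module_mat TYPE(complex) D D) (\<lambda>k. complex_of_real (p k) \<cdot>\<^sub>m E k \<rho>) K"

definition perfect_encryption ::
    "nat \<Rightarrow> nat \<Rightarrow> 'k set \<Rightarrow> ('k \<Rightarrow> real) \<Rightarrow> ('k \<Rightarrow> complex mat \<Rightarrow> complex mat) \<Rightarrow> bool" where
  "perfect_encryption d D K p E \<longleftrightarrow>
     probability_distribution K p \<and>
     (\<forall>k \<in> K. invertible_operation d D (E k)) \<and>
     (\<exists>\<sigma>. quantum_state D \<sigma> \<and>
       (\<forall>\<rho>. quantum_state d \<rho> \<longrightarrow> encryption_map D K p E \<rho> = \<sigma>))"

(* The convention 0 * log 2 0 = 0 holds automatically, whatever log 2 0 is. *)
definition shannon_entropy :: "'k set \<Rightarrow> ('k \<Rightarrow> real) \<Rightarrow> real" where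
  "shannon_entropy K p = - (\<Sum>k\<in>K. p k * log 2 (p k))"

end

theory Submission
  imports Defs
begin

text \<open>Encrypt one half of a maximally entangled pair and decrypt it with the key \<open>k\<close>.  Measuring the
  overlap with the entangled pair gives \<open>1\<close> for the key \<open>k\<close> itself, something nonnegative for every
  other key, and \<open>1 / d\<^sup>2\<close> on average, because perfect encryption destroys all correlations.
  Hence every \<open>p k\<close> is at most \<open>1 / d\<^sup>2\<close>, so already the min-entropy is at least \<open>2 log d\<close>.\<close>

section \<open>Positive matrices, and linear maps known only on states\<close>

definition matrix_unit :: "nat \<Rightarrow> nat \<Rightarrow> nat \<Rightarrow> complex mat" where
  "matrix_unit d a b = mat d d (\<lambda>(i, j). if i = a \<and> j = b then 1 else 0)"

lemma matrix_unit_carrier [simp]: "matrix_unit d a b \<in> carrier_mat d d"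
  by (simp add: matrix_unit_def)

text \<open>The quadratic form of \<open>c v v*\<close> at \<open>u\<close> is \<open>c\<close>
  times the squared modulus of the inner product of \<open>u\<close> and \<open>v\<close>. This
  serves both the pure states below and the entangled projector.\<close>

lemma pos_semidef_rank_one:
  fixes v :: "nat \<Rightarrow> complex"
  assumes "c \<ge> 0"
  shows "pos_semidef d (mat d d (\<lambda>(i, j). of_real c * v i * cnj (v j)))" (is "pos_semidef d ?A")
proof -
  have adj: "mat_adjoint ?A = ?A"
    by (rule eq_matI) (auto simp: mat_adjoint_def mat_of_rows_def conjugate_complex_def)
  have "0 \<le> Re ((?A *\<^sub>v u) \<bullet>c u)" if u: "u \<in> carrier_vec d" for u
  proof -
    let ?s = "\<Sum>j\<in>{0..<d}. cnj (v j) * u $ j"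
    have "(?A *\<^sub>v u) \<bullet>c u = (\<Sum>i\<in>{0..<d}. (\<Sum>j\<in>{0..<d}. of_real c * v i * cnj (v j) * u $ j) * cnj (u $ i))"
      using u by (auto simp: scalar_prod_def intro!: sum.cong)
    also have "\<dots> = of_real c * ?s * cnj ?s"
      by (simp add: sum_distrib_left sum_distrib_right mult_ac) (subst sum.swap, simp)
    also have "\<dots> = of_real (c * (cmod ?s)\<^sup>2)"
      by (simp only: mult.assoc complex_norm_square of_real_mult)
    finally show ?thesis using assms by simp
  qed
  with adj show ?thesis by (auto simp: pos_semidef_def)
qed

text \<open>Such a functional is \<open>t\<close> times the trace: pure states determine it by
  polarisation. This carries hypotheses about states over to matrix units, which are not Hermitian
  off the diagonal.\<close>

lemma linear_functional_matrix_unit: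
  fixes f :: "complex mat \<Rightarrow> complex"
  assumes add: "\<And>A B. A \<in> carrier_mat d d \<Longrightarrow> B \<in> carrier_mat d d \<Longrightarrow> f (A + B) = f A + f B"
    and smult: "\<And>c A. A \<in> carrier_mat d d \<Longrightarrow> f (c \<cdot>\<^sub>m A) = c * f A"
    and const: "\<And>\<rho>. quantum_state d \<rho> \<Longrightarrow> f \<rho> = t"
    and ab: "a < d" "b < d"
  shows "f (matrix_unit d a b) = (if a = b then t else 0)"
proof -
  have diag: "f (matrix_unit d a a) = t" if "a < d" for a
  proof (rule const)
    have "matrix_unit d a a = mat d d (\<lambda>(i, j). of_real 1 * (if i = a then 1 else 0) * cnj (if j = a then 1 else 0))"
      by (rule eq_matI) (auto simp: matrix_unit_def)
    moreover have "mat_trace (matrix_unit d a a) = 1"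
      using that by (simp add: mat_trace_def matrix_unit_def)
    ultimately show "quantum_state d (matrix_unit d a a)"
      unfolding quantum_state_def by (metis pos_semidef_rank_one zero_le_one)
  qed
  show ?thesis
  proof (cases "a = b")
    case True
    then show ?thesis using diag ab by simp
  next
    case False
    let ?e = "matrix_unit d"
    \<comment> \<open>the state \<open>(e\<^sub>a + \<omega> e\<^sub>b) / \<surd>2\<close>\<close>
    define \<rho> where "\<rho> \<omega> = mat d d (\<lambda>(i, j). of_real (1/2) *
        (if i = a then 1 else if i = b then \<omega> else 0) * cnj (if j = a then 1 else if j = b then \<omega> else 0))"
      for \<omega> :: complex
    \<comment> \<open>The two diagonal units in \<open>\<rho> \<omega>\<close> already contribute
      \<open>(t + t) / 2 = t\<close>, so the cross terms must cancel.\<close>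
    have polar: "cnj \<omega> * f (?e a b) + \<omega> * f (?e b a) = 0" if \<omega>: "\<omega> * cnj \<omega> = 1" for \<omega>
    proof -
      have "mat_trace (\<rho> \<omega>) = (\<Sum>i<d. (if i = a then 1/2 else 0) + (if i = b then 1/2 else 0))"
        unfolding mat_trace_def \<rho>_def
        by (rule sum.cong) (use \<omega> False in \<open>simp_all add: mult.assoc\<close>)
      also have "\<dots> = 1" using ab by (simp add: sum.distrib)
      finally have "quantum_state d (\<rho> \<omega>)"
        unfolding quantum_state_def \<rho>_def by (simp add: pos_semidef_rank_one del: of_real_divide)
      then have "f (\<rho> \<omega>) = t" by (rule const)
      moreover have "\<rho> \<omega> = (1/2) \<cdot>\<^sub>m ((?e a a + ?e b b) + (cnj \<omega> \<cdot>\<^sub>m ?e a b + \<omega> \<cdot>\<^sub>m ?e b a))"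
        by (rule eq_matI) (use \<omega> False in \<open>auto simp: \<rho>_def matrix_unit_def\<close>)
      ultimately show ?thesis
        using diag[OF ab(1)] diag[OF ab(2)] by (simp add: add smult field_simps)
    qed
    \<comment> \<open>The phases 1 and \<open>\<i>\<close> give two independent equations: the
      values at \<open>?e a b\<close> and \<open>?e b a\<close> have sum 0 and difference 0.\<close>
    have "f (?e a b) + f (?e b a) = 0" using polar[of 1] by simp
    moreover have "f (?e a b) = f (?e b a)" using polar[of \<i>] by simp
    ultimately show ?thesis using False by simp
  qed
qed

text \<open>\<open>encryption_map\<close> adds up in the module of matrices; passing to entries
  turns this into an ordinary sum of complex numbers.\<close>

lemma linear_on_mat_finsum:
  assumes L: "linear_on_mat D d L" and "finite K"
    and f: "\<And>k. k \<in> K \<Longrightarrow> f k \<in> carrier_mat D D" and ij: "i < d" "j < d"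
  shows "L (finsum (module_mat TYPE(complex) D D) f K) $$ (i, j) = (\<Sum>k\<in>K. L (f k) $$ (i, j))"
proof -
  let ?M = "module_mat TYPE(complex) D D"
  interpret abelian_group ?M by (rule abelian_group_mat)
  have carr: "carrier ?M = carrier_mat D D" and z: "\<zero>\<^bsub>?M\<^esub> = 0\<^sub>m D D"
    and plus: "\<And>A B. A \<oplus>\<^bsub>?M\<^esub> B = A + B"
    by (simp_all add: module_mat_def)
  have L0: "L (0\<^sub>m D D) $$ (i, j) = 0"
  proof -
    have L0_carr: "L (0\<^sub>m D D) \<in> carrier_mat d d" using L by (simp add: linear_on_mat_def)
    \<comment> \<open>The empty sum requires that \<open>L\<close> kill the zero matrix, which is
      homogeneity with scalar 0.\<close>
    have "L (0\<^sub>m D D) = L (0 \<cdot>\<^sub>m 0\<^sub>m D D)" by (rule arg_cong[of _ _ L]) auto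
    also have "\<dots> = 0 \<cdot>\<^sub>m L (0\<^sub>m D D)" using L unfolding linear_on_mat_def by (metis zero_carrier_mat)
    finally have "L (0\<^sub>m D D) $$ (i, j) = (0 \<cdot>\<^sub>m L (0\<^sub>m D D)) $$ (i, j)" by (rule arg_cong)
    also have "\<dots> = 0" using L0_carr ij by simp
    finally show ?thesis .
  qed
  from \<open>finite K\<close> f show ?thesis
  proof (induction K)
    case empty
    then show ?case by (simp add: L0 z)
  next
    case (insert k K)
    have "finsum ?M f K \<in> carrier_mat D D"
      using finsum_closed[of f K] insert.prems by (auto simp: carr)
    moreover have "f k \<in> carrier_mat D D" using insert.prems by simp
    ultimately have "L (f k + finsum ?M f K) = L (f k) + L (finsum ?M f K)"
      "L (finsum ?M f K) \<in> carrier_mat d d"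
      using L by (auto simp: linear_on_mat_def)
    moreover have "finsum ?M f (insert k K) = f k + finsum ?M f K"
      using insert by (subst finsum_insert) (auto simp: carr plus)
    ultimately show ?case using insert ij by simp
  qed
qed

section \<open>Ampliations and complete positivity\<close>

lemma block_index_less:
  fixes i r m D :: nat
  assumes "i < m" "r < D"
  shows "i * D + r < m * D"
proof -
  have "i * D + r < Suc i * D" using assms by simp
  also have "\<dots> \<le> m * D" using assms by (intro mult_le_mono1) simp
  finally show ?thesis .
qed

text \<open>Ampliation acts block by block: each block of \<open>ampliation m d D E X\<close> is
  \<open>E\<close> of the corresponding block of \<open>X\<close>, and \<open>F\<close> is then
  applied to exactly that block.\<close>

lemma ampliation_compose:
  assumes "D > 0" and "\<And>A. A \<in> carrier_mat d d \<Longrightarrow> E A \<in> carrier_mat D D"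
  shows "ampliation m D d' F (ampliation m d D E X) = ampliation m d d' (F \<circ> E) X"
proof (rule eq_matI)
  let ?B = "\<lambda>i j. mat d d (\<lambda>(r, s). X $$ (i * d + r, j * d + s))"
  have block: "mat D D (\<lambda>(r, s). ampliation m d D E X $$ (i * D + r, j * D + s)) = E (?B i j)"
    if "i < m" "j < m" for i j
    using assms(2)[of "?B i j"] that assms(1) by (intro eq_matI) (auto simp: ampliation_def block_index_less)
  fix i j assume ij: "i < dim_row (ampliation m d d' (F \<circ> E) X)" "j < dim_col (ampliation m d d' (F \<circ> E) X)"
  then have "i < m * d'" "j < m * d'" by (auto simp: ampliation_def)
  moreover from this have "i div d' < m" "j div d' < m"
    by (auto intro: less_mult_imp_div_less)
  ultimately show "ampliation m D d' F (ampliation m d D E X) $$ (i, j) = ampliation m d d' (F \<circ> E) X $$ (i, j)"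
    by (subst ampliation_def) (simp add: block, simp add: ampliation_def)
qed (auto simp: ampliation_def)

lemma completely_positive_compose:
  assumes "D > 0" "linear_on_mat d D E" "completely_positive d D E" "completely_positive D d' F"
  shows "completely_positive d d' (F \<circ> E)"
  using assms ampliation_compose[of D d E _ d' F]
  unfolding completely_positive_def linear_on_mat_def by metis

text \<open>The sum is the overlap with the unnormalised entangled vector \<open>\<Sum>\<^sub>a e\<^sub>a \<otimes> e\<^sub>a\<close> after the map
  acts on its second half; \<open>\<chi>\<close> below is the indicator of the support of this vector.\<close>

lemma completely_positive_overlap_nonneg:
  assumes "completely_positive d d G"
  shows "0 \<le> Re (\<Sum>a<d. \<Sum>b<d. G (matrix_unit d a b) $$ (a, b))"
proof -
  define \<chi> :: "nat \<Rightarrow> complex" where "\<chi> i = (if i div d = i mod d then 1 else 0)" for i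
  define X where "X = mat (d * d) (d * d) (\<lambda>(i, j). of_real 1 * \<chi> i * cnj (\<chi> j))"
  define Y where "Y = ampliation d d d G X"
  define w where "w = vec (d * d) \<chi>"
  have "pos_semidef (d * d) Y"
    using assms pos_semidef_rank_one[of 1 "d * d" \<chi>]
    unfolding completely_positive_def X_def Y_def by simp
  then have "0 \<le> Re ((Y *\<^sub>v w) \<bullet>c w)" by (auto simp: pos_semidef_def w_def)
  \<comment> \<open>\<open>\<chi>\<close> takes only the values 0 and 1, so the conjugation in the
    inner product drops out.\<close>
  also have "(Y *\<^sub>v w) \<bullet>c w = (\<Sum>i<d * d. (\<Sum>j<d * d. Y $$ (i, j) * \<chi> j) * \<chi> i)"
    by (auto simp: scalar_prod_def w_def Y_def ampliation_def \<chi>_def lessThan_atLeast0 intro!: sum.cong)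
  also have "\<dots> = (\<Sum>a<d. \<Sum>b<d. Y $$ (a * d + a, b * d + b))"
  proof -
    have diag: "(\<Sum>i<d * d. g i * \<chi> i) = (\<Sum>a<d. g (a * d + a))" for g :: "nat \<Rightarrow> complex"
    proof -
      have "(\<Sum>i<d * d. g i * \<chi> i) = (\<Sum>i\<in>{i\<in>{..<d * d}. i div d = i mod d}. g i)"
        unfolding \<chi>_def by (subst sum.inter_filter) (auto intro!: sum.cong)
      also have "\<dots> = (\<Sum>a<d. g (a * d + a))"
      proof (rule sum.reindex_bij_witness[of _ "\<lambda>a. a * d + a" "\<lambda>i. i div d"])
        fix a assume "a \<in> {..<d}"
        then show "a * d + a \<in> {i \<in> {..<d * d}. i div d = i mod d}"
          by (simp add: block_index_less)
      next
        fix i assume i: "i \<in> {i \<in> {..<d * d}. i div d = i mod d}"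
        have "i div d * d + i mod d = i" by (rule div_mult_mod_eq)
        with i show "i div d * d + i div d = i" "g (i div d * d + i div d) = g i" by auto
        from i have "i < d * d" by simp
        then have "i div d < d" by (rule less_mult_imp_div_less)
        then show "i div d \<in> {..<d}" by simp
      qed auto
      finally show ?thesis .
    qed
    show ?thesis by (simp only: diag)
  qed
  also have "\<dots> = (\<Sum>a<d. \<Sum>b<d. G (matrix_unit d a b) $$ (a, b))"
  proof (intro sum.cong refl)
    fix a b assume "a \<in> {..<d}" "b \<in> {..<d}"
    then have ab: "a < d" "b < d" by auto
    \<comment> \<open>The blocks of the unnormalised entangled projector \<open>X\<close> are the
      matrix units, so \<open>Y\<close> is the Choi matrix of \<open>G\<close>.\<close>
    have "mat d d (\<lambda>(r, s). X $$ (a * d + r, b * d + s)) = matrix_unit d a b"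
      using ab by (intro eq_matI) (auto simp: X_def matrix_unit_def \<chi>_def block_index_less)
    then show "Y $$ (a * d + a, b * d + b) = G (matrix_unit d a b) $$ (a, b)"
      using ab by (simp add: Y_def ampliation_def block_index_less)
  qed
  finally show ?thesis .
qed

section \<open>Upper bound on each key probability\<close>

lemma perfect_encryption_key_bound:
  assumes enc: "perfect_encryption d D K p E" and k: "k \<in> K"
  shows "p k * (real d)\<^sup>2 \<le> 1"
proof -
  obtain \<sigma> where \<sigma>: "quantum_state D \<sigma>"
    and R: "\<And>\<rho>. quantum_state d \<rho> \<Longrightarrow> encryption_map D K p E \<rho> = \<sigma>"
    and fin: "finite K" and p0: "\<And>j. j \<in> K \<Longrightarrow> 0 \<le> p j"
    and inv: "\<And>j. j \<in> K \<Longrightarrow> invertible_operation d D (E j)"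
    using enc by (auto simp: perfect_encryption_def probability_distribution_def)
  have E: "quantum_operation d D (E j)" if "j \<in> K" for j
    using inv[OF that] by (simp add: invertible_operation_def)
  obtain F where F: "quantum_operation D d F"
    and FE: "\<And>\<rho>. quantum_state d \<rho> \<Longrightarrow> F (E k \<rho>) = \<rho>"
    using inv[OF k] by (auto simp: invertible_operation_def)
  \<comment> \<open>A matrix of size 0 has trace 0, whereas the state \<open>\<sigma>\<close> has
    trace 1.\<close>
  have "D > 0" using \<sigma> by (cases D) (auto simp: quantum_state_def pos_semidef_def mat_trace_def)
  have \<sigma>_carr: "\<sigma> \<in> carrier_mat D D" using \<sigma> by (simp add: quantum_state_def pos_semidef_def)
  have E_carr: "E j A \<in> carrier_mat D D" if "j \<in> K" "A \<in> carrier_mat d d" for j A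
    using E[OF that(1)] that(2) by (simp add: quantum_operation_def linear_on_mat_def)
  have E_add: "E j (A + B) = E j A + E j B" if "j \<in> K" "A \<in> carrier_mat d d" "B \<in> carrier_mat d d" for j A B
    using E[OF that(1)] that by (simp add: quantum_operation_def linear_on_mat_def)
  have E_smult: "E j (c \<cdot>\<^sub>m A) = c \<cdot>\<^sub>m E j A" if "j \<in> K" "A \<in> carrier_mat d d" for j c A
    using E[OF that(1)] that by (simp add: quantum_operation_def linear_on_mat_def)
  have F_lin: "linear_on_mat D d F" using F by (simp add: quantum_operation_def)
  then have F_carr: "F A \<in> carrier_mat d d"
    and F_add: "B \<in> carrier_mat D D \<Longrightarrow> F (A + B) = F A + F B"
    and F_smult: "F (c \<cdot>\<^sub>m A) = c \<cdot>\<^sub>m F A" if "A \<in> carrier_mat D D" for A B c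
    using that by (simp_all add: linear_on_mat_def)
  have G_carr: "F (E j A) \<in> carrier_mat d d" if "j \<in> K" "A \<in> carrier_mat d d" for j A
    by (intro F_carr E_carr that)
  have G_add: "F (E j (A + B)) $$ (a, b) = F (E j A) $$ (a, b) + F (E j B) $$ (a, b)"
    if "j \<in> K" "A \<in> carrier_mat d d" "B \<in> carrier_mat d d" "a < d" "b < d" for j A B a b
    using that G_carr[of j A] G_carr[of j B] by (simp add: E_add F_add E_carr)
  have G_smult: "F (E j (c \<cdot>\<^sub>m A)) $$ (a, b) = c * F (E j A) $$ (a, b)"
    if "j \<in> K" "A \<in> carrier_mat d d" "a < d" "b < d" for j A c a b
    using that G_carr[of j A] by (simp add: E_smult F_smult E_carr)
  \<comment> \<open>The entangled vector has squared norm \<open>d\<close>, so \<open>q j\<close> is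
    the normalised overlap times the square of \<open>d\<close>. The decryption map \<open>F\<close>
    stays the one for key \<open>k\<close>, whichever key \<open>j\<close> encrypts.\<close>
  define q where "q j = (\<Sum>a<d. \<Sum>b<d. F (E j (matrix_unit d a b)) $$ (a, b))" for j
  have q_nonneg: "0 \<le> Re (q j)" if "j \<in> K" for j
    using completely_positive_overlap_nonneg[OF completely_positive_compose[OF \<open>D > 0\<close>, of d "E j" d F]]
      E[OF that] F by (simp add: q_def quantum_operation_def)
  have q_k: "q k = of_real ((real d)\<^sup>2)"
  proof -
    have "F (E k (matrix_unit d a b)) $$ (a, b) = 1" if ab: "a < d" "b < d" for a b
    proof -
      \<comment> \<open>Decryption is known to be the identity on states only; the deviation
        \<open>?f\<close> vanishes on every state, hence on matrix units.\<close>
      let ?f = "\<lambda>A. F (E k A) $$ (a, b) - A $$ (a, b)"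
      have "?f (matrix_unit d a b) = (if a = b then 0 else 0)"
        using ab k by (intro linear_functional_matrix_unit)
          (simp_all add: G_add G_smult FE algebra_simps)
      then show ?thesis using ab by (simp add: matrix_unit_def)
    qed
    then show ?thesis by (simp add: q_def power2_eq_square)
  qed
  have avg: "(\<Sum>j\<in>K. of_real (p j) * q j) = 1"
  proof -
    \<comment> \<open>On states this average over keys is the entry \<open>(a, b)\<close> of
      \<open>F \<sigma>\<close>, whatever the input. On matrix units the terms with
      \<open>a \<noteq> b\<close> therefore vanish, and the rest add up to the trace of
      \<open>F \<sigma>\<close>.\<close>
    have "(\<Sum>j\<in>K. of_real (p j) * F (E j (matrix_unit d a b)) $$ (a, b)) = (if a = b then F \<sigma> $$ (a, b) else 0)"
      if ab: "a < d" "b < d" for a b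
    proof (rule linear_functional_matrix_unit)
      fix \<rho> assume \<rho>: "quantum_state d \<rho>"
      then have \<rho>_carr: "\<rho> \<in> carrier_mat d d" by (simp add: quantum_state_def pos_semidef_def)
      have "F \<sigma> $$ (a, b) = (\<Sum>j\<in>K. F (of_real (p j) \<cdot>\<^sub>m E j \<rho>) $$ (a, b))"
        unfolding R[OF \<rho>, symmetric] encryption_map_def
        by (rule linear_on_mat_finsum[OF F_lin fin]) (auto simp: ab E_carr \<rho>_carr)
      also have "\<dots> = (\<Sum>j\<in>K. of_real (p j) * F (E j \<rho>) $$ (a, b))"
      proof (intro sum.cong refl)
        fix j assume "j \<in> K"
        with G_carr[OF this \<rho>_carr] ab \<rho>_carr
        show "F (of_real (p j) \<cdot>\<^sub>m E j \<rho>) $$ (a, b) = of_real (p j) * F (E j \<rho>) $$ (a, b)"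
          by (simp add: F_smult E_carr)
      qed
      finally show "(\<Sum>j\<in>K. of_real (p j) * F (E j \<rho>) $$ (a, b)) = F \<sigma> $$ (a, b)" by simp
    qed (use ab in \<open>simp_all add: G_add G_smult sum.distrib sum_distrib_left algebra_simps\<close>)
    then have "(\<Sum>a<d. \<Sum>b<d. \<Sum>j\<in>K. of_real (p j) * F (E j (matrix_unit d a b)) $$ (a, b)) = (\<Sum>a<d. F \<sigma> $$ (a, a))"
      by simp
    also have "\<dots> = mat_trace (F \<sigma>)" using F_carr[OF \<sigma>_carr] by (simp add: mat_trace_def)
    also have "\<dots> = 1"
      using F \<sigma> \<sigma>_carr by (simp add: quantum_operation_def trace_preserving_def quantum_state_def)
    finally have "(\<Sum>a<d. \<Sum>b<d. \<Sum>j\<in>K. of_real (p j) * F (E j (matrix_unit d a b)) $$ (a, b)) = 1" .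
    moreover have "(\<Sum>j\<in>K. of_real (p j) * q j)
        = (\<Sum>a<d. \<Sum>b<d. \<Sum>j\<in>K. of_real (p j) * F (E j (matrix_unit d a b)) $$ (a, b))"
      unfolding q_def sum_distrib_left by (subst sum.swap, intro sum.cong refl, rule sum.swap)
    ultimately show ?thesis by simp
  qed
  have "p k * (real d)\<^sup>2 = p k * Re (q k)" by (simp only: q_k Re_complex_of_real)
  also have "\<dots> \<le> (\<Sum>j\<in>K. p j * Re (q j))"
    using p0 q_nonneg by (intro member_le_sum k fin) auto
  also have "\<dots> = Re (\<Sum>j\<in>K. of_real (p j) * q j)" by simp
  also have "\<dots> = 1" by (simp add: avg)
  finally show ?thesis .
qed

section \<open>From key probabilities to entropy\<close>

text \<open>Every key of positive probability has surprisal \<open>- log 2 (p k)\<close> at least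
  \<open>log 2 c\<close>, and the entropy averages the surprisals with weights of sum 1.\<close>

lemma shannon_entropy_ge_min_entropy:
  assumes p: "probability_distribution K p" and "c > 0" and bound: "\<And>k. k \<in> K \<Longrightarrow> p k * c \<le> 1"
  shows "log 2 c \<le> shannon_entropy K p"
proof -
  have "p k * log 2 c \<le> - (p k * log 2 (p k))" if k: "k \<in> K" for k
  \<comment> \<open>For \<open>p k = 0\<close> both sides are 0; dividing out logarithms is possible
    only for positive \<open>p k\<close>.\<close>
  proof (cases "p k = 0")
    case False
    with k p have pos: "p k > 0" by (simp add: probability_distribution_def order.strict_iff_order)
    have "log 2 (p k * c) \<le> log 2 1"
      using bound[OF k] pos \<open>c > 0\<close> by (subst log_le_cancel_iff) auto
    then have "log 2 c \<le> - log 2 (p k)" using pos \<open>c > 0\<close> by (simp add: log_mult)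
    then have "p k * log 2 c \<le> p k * - log 2 (p k)" using pos by (intro mult_left_mono) auto
    then show ?thesis by simp
  qed simp
  then have "(\<Sum>k\<in>K. p k * log 2 c) \<le> (\<Sum>k\<in>K. - (p k * log 2 (p k)))" by (rule sum_mono)
  then show ?thesis
    using p by (simp add: shannon_entropy_def sum_negf probability_distribution_def
        flip: sum_distrib_right)
qed

theorem theorem3p4:
  fixes n D :: nat
    and K :: "'k set"
    and p :: "'k \<Rightarrow> real"
    and E :: "'k \<Rightarrow> complex mat \<Rightarrow> complex mat"
  assumes "n > 0"
    and "perfect_encryption (2 ^ n) D K p E"
  shows "shannon_entropy K p \<ge> 2 * real n"
proof -
  let ?c = "(real (2 ^ n))\<^sup>2"
  have "log 2 ?c \<le> shannon_entropy K p"
    using assms(2) perfect_encryption_key_bound[OF assms(2)]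
    by (intro shannon_entropy_ge_min_entropy) (auto simp: perfect_encryption_def)
  moreover have "log 2 ?c = 2 * real n" by (simp add: log_nat_power)
  ultimately show ?thesis by simp
qed

end
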